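(* Let $p$ be an odd prime and let $\lambda\in\mathbb{C}_p$ with $|\lambda|_p\ge1$. Then for every integer $n\ge1$, \[ -(n-1)!\,(-\lambda)^{n-1}=\beta_{n,\lambda}-(-1)^n\beta_{n,-\lambda}. \] Moreover, for every $a\in\frac{1}{\lambda}E$ with $a\neq0$, \[ \frac{a}{2}\coth_\lambda\Big(\frac12:a\Big)=\sum_{n=0}^\infty\left(\sum_{m=0}^n\binom{n}{m}\frac{\beta_{m,\lambda}+(-1)^m\beta_{m,-\lambda}}{2}\,C_{n-m}\,\lambda^{n-m}\right)\frac{a^n}{n!}. \]
   Context: $\mathbb{C}_p$ is the completion of an algebraic closure of $\mathbb{Q}_p$, with $|p|_p=1/p$; $\mathbb{Z}_p$ is the ring of $p$-adic integers. Let $E=\{x\in\mathbb{C}_p: |x|_p<p^{-1/(p-1)}\}$ and $\frac{1}{\lambda}E=\{t\in\mathbb{C}_p:\lambda t\in E\}$. Let $\log$ and $\exp$ denote the $p$-adic logarithm and exponential. The generalized falling factorials are $(x)_{0,\lambda}=1$, $(x)_{n,\lambda}=x(x-\lambda)\cdots(x-(n-1)\lambda)$ for $n\ge1$. For $a\in\frac1\lambda E$ and $|x|_p\le|\lambda|_p$, the degenerate exponential is $e^x_\lambda(a)=(1+\lambda a)^{x/\lambda}=\exp\big(\tfrac{x}{\lambda}\log(1+\lambda a)\big)=\sum_{n\ge0}(x)_{n,\lambda}\frac{a^n}{n!}$. The degenerate hyperbolic functions are $\cosh_\lambda(x:a)=\frac12\big(e^x_\lambda(a)+e^{-x}_\lambda(a)\big)$,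 $\sinh_\lambda(x:a)=\frac12\big(e^x_\lambda(a)-e^{-x}_\lambda(a)\big)$, and $\coth_\lambda(x:a)=\cosh_\lambda(x:a)/\sinh_\lambda(x:a)$ (for $x\ne0$, $a\ne0$). The Volkenborn integral of a uniformly differentiable $f:\mathbb{Z}_p\to\mathbb{C}_p$ is $\int_{\mathbb{Z}_p}f(x)\,d\mu(x)=\lim_{N\to\infty}p^{-N}\sum_{x=0}^{p^N-1}f(x)$. The degenerate Bernoulli numbers are $\beta_{n,\lambda}=\int_{\mathbb{Z}_p}(x)_{n,\lambda}\,d\mu(x)$ (equivalently $\frac{\frac1\lambda\log(1+\lambda t)}{e_\lambda(t)-1}=\sum_{n\ge0}\beta_{n,\lambda}\frac{t^n}{n!}$ with $e_\lambda(t)=e^1_\lambda(t)$). The Cauchy numbers of the first kind $C_n$ are defined by $\frac{t}{\log(1+t)}=\sum_{n\ge0}C_n\frac{t^n}{n!}$. *)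

theory Defs
  imports
    "HOL-Analysis.Analysis"
    "HOL-Computational_Algebra.Computational_Algebra"
begin

text \<open>The absolute value of a field carrying a translation-invariant metric.\<close>

definition padic_abs :: "'a::{field_char_0, metric_space} \<Rightarrow> real" where
  "padic_abs x = dist x 0"

text \<open>
  The field of \<open>p\<close>-adic numbers inside a complete extension of the \<open>p\<close>-adically valued rationals is
  the topological closure of the rationals.
\<close>

definition Qp :: "'a::{field_char_0, metric_space} set" where
  "Qp = closure \<rat>"

definition Qp_bar :: "'a::{field_char_0, metric_space} set" where
  "Qp_bar = {x. \<exists>q. q \<noteq> 0 \<and> (\<forall>i. poly.coeff q i \<in> Qp) \<and> poly q x = 0}"

text \<open>
  The type \<open>'a\<close> is a copy of \<open>\<complex>\<^sub>p\<close>, the completion of an algebraic closure of the field of \<open>p\<close>-adic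
  numbers: it is a complete field (completeness is part of the sort) whose metric comes from a
  non-archimedean absolute value normalised by \<open>|p| = 1/p\<close>, and the elements algebraic over
  the closure of the rationals form an algebraically closed and dense subset.
  These conditions determine \<open>'a\<close> up to isometric isomorphism.
\<close>

definition padic_complex :: "nat \<Rightarrow> 'a::{field_char_0, complete_space} itself \<Rightarrow> bool" where
  "padic_complex p (T :: 'a itself) \<longleftrightarrow>
     prime p \<and>
     (\<forall>x y :: 'a. dist x y = padic_abs (x - y)) \<and>
     (\<forall>x y :: 'a. padic_abs (x * y) = padic_abs x * padic_abs y) \<and>
     (\<forall>x y :: 'a. padic_abs (x + y) \<le> max (padic_abs x) (padic_abs y)) \<and>
     padic_abs (of_nat p :: 'a) = 1 / real p \<and>
     (\<forall>q :: 'a poly. (\<forall>i. poly.coeff q i \<in> Qp_bar) \<and> degree q > 0 \<longrightarrow>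
        (\<exists>x\<in>Qp_bar. poly q x = 0)) \<and>
     closure (Qp_bar :: 'a set) = UNIV"

definition E_disc :: "nat \<Rightarrow> 'a::{field_char_0, metric_space} set" where
  "E_disc p = {x. padic_abs x < real p powr (- 1 / (real p - 1))}"

definition scaled_E_disc :: "nat \<Rightarrow> 'a::{field_char_0, metric_space} \<Rightarrow> 'a set" where
  "scaled_E_disc p lam = {t. lam * t \<in> E_disc p}"

definition padic_log :: "'a::{field_char_0, metric_space} \<Rightarrow> 'a" where
  "padic_log z = (\<Sum>n. (- 1) ^ n * (z - 1) ^ Suc n / of_nat (Suc n))"

definition padic_exp :: "'a::{field_char_0, metric_space} \<Rightarrow> 'a" where
  "padic_exp x = (\<Sum>n. x ^ n / fact n)"

definition deg_falling :: "'a::field_char_0 \<Rightarrow> 'a \<Rightarrow> nat \<Rightarrow> 'a" where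
  "deg_falling lam x n = (\<Prod>i<n. x - of_nat i * lam)"

definition deg_exp :: "'a::{field_char_0, metric_space} \<Rightarrow> 'a \<Rightarrow> 'a \<Rightarrow> 'a" where
  "deg_exp lam x a = padic_exp (x / lam * padic_log (1 + lam * a))"

definition deg_cosh :: "'a::{field_char_0, metric_space} \<Rightarrow> 'a \<Rightarrow> 'a \<Rightarrow> 'a" where
  "deg_cosh lam x a = (deg_exp lam x a + deg_exp lam (- x) a) / 2"

definition deg_sinh :: "'a::{field_char_0, metric_space} \<Rightarrow> 'a \<Rightarrow> 'a \<Rightarrow> 'a" where
  "deg_sinh lam x a = (deg_exp lam x a - deg_exp lam (- x) a) / 2"

definition deg_coth :: "'a::{field_char_0, metric_space} \<Rightarrow> 'a \<Rightarrow> 'a \<Rightarrow> 'a" where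
  "deg_coth lam x a = deg_cosh lam x a / deg_sinh lam x a"

text \<open>
  The Volkenborn integral over the \<open>p\<close>-adic integers. Only the values of \<open>f\<close> at natural numbers
  enter; the limit exists whenever \<open>f\<close> is uniformly differentiable on the closure of the integers,
  in particular for polynomial functions.
\<close>

definition volkenborn :: "nat \<Rightarrow> ('a::{field_char_0, metric_space} \<Rightarrow> 'a) \<Rightarrow> 'a" where
  "volkenborn p f = lim (\<lambda>N. (\<Sum>x = 0..<p ^ N. f (of_nat x)) / of_nat p ^ N)"

definition deg_bernoulli :: "nat \<Rightarrow> nat \<Rightarrow> 'a::{field_char_0, metric_space} \<Rightarrow> 'a" where
  "deg_bernoulli p n lam = volkenborn p (\<lambda>x. deg_falling lam x n)"

text \<open>
  The Cauchy numbers of the first kind, with exponential generating function \<open>t / log (1 + t)\<close>;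
  \<open>fps_ln 1\<close> is the formal power series of \<open>log (1 + t)\<close>.
\<close>

definition cauchy_number :: "nat \<Rightarrow> 'a::field_char_0" where
  "cauchy_number n = fact n * fps_nth (fps_X / fps_ln 1) n"

end

theory Submission
  imports Defs
begin

text \<open>
  Put \<open>t = \<lambda> a\<close> and \<open>\<mu> = 1 / \<lambda>\<close>. Summing the geometric progression of the formal series
  \<open>(1 + t)^(x \<mu>)\<close> over \<open>x < p^N\<close> and letting \<open>p^N\<close> tend to \<open>0\<close> shows that the numbers
  \<open>\<beta>\<^sub>n\<^sub>,\<^sub>\<lambda> / (\<lambda>^n n!)\<close> are the coefficients of \<open>G \<mu> = \<mu> log (1 + t) / ((1 + t)^\<mu> - 1)\<close>. Formally
  \<open>G \<mu> - G (- \<mu>) = - \<mu> log (1 + t)\<close>, which is the first identity, while \<open>G \<mu> + G (- \<mu>)\<close> multiplied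
  by the generating function \<open>t / log (1 + t)\<close> of the Cauchy numbers is the formal hyperbolic cotangent.

  To evaluate the second identity at \<open>|t| < r = p^(- 1 / (p - 1))\<close>, consider the power series whose
  coefficients satisfy \<open>|c\<^sub>n| r^n \<le> 1\<close>. They form a ring closed under inversion of series with
  constant term \<open>1\<close>, evaluation at \<open>t\<close> is a ring homomorphism compatible with composition, and by
  \<open>|n!| \<ge> r^(n - 1)\<close> the series \<open>log (1 + t)\<close>, \<open>(1 + t)^y\<close> for \<open>|y| \<le> 1\<close> and the
  normalised difference \<open>((1 + t)^y - (1 + t)^(- y)) / (2 y t)\<close> belong to it.
\<close>

section \<open>Power series over an ultrametric field\<close>

locale ultrametric_field =
  fixes T :: "'a::{field_char_0, complete_space} itself"
  assumes dist_eq: "dist x y = padic_abs (x - y :: 'a)"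
    and padic_abs_mult: "padic_abs (x * y :: 'a) = padic_abs x * padic_abs y"
    and padic_abs_add_le: "padic_abs (x + y :: 'a) \<le> max (padic_abs x) (padic_abs y)"
begin

section \<open>Elementary properties of the ultrametric absolute value\<close>

lemma padic_abs_nonneg [simp]: "padic_abs (x :: 'a) \<ge> 0"
  by (simp add: padic_abs_def)

lemma padic_abs_0 [simp]: "padic_abs (0 :: 'a) = 0"
  by (simp add: padic_abs_def)

lemma padic_abs_eq_0_iff [simp]: "padic_abs (x :: 'a) = 0 \<longleftrightarrow> x = 0"
  by (simp add: padic_abs_def)

lemma padic_abs_pos_iff [simp]: "padic_abs (x :: 'a) > 0 \<longleftrightarrow> x \<noteq> 0"
  by (simp add: padic_abs_def)

lemma padic_abs_1 [simp]: "padic_abs (1 :: 'a) = 1"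
  using padic_abs_mult[of 1 1] padic_abs_eq_0_iff[of 1] by simp

lemma padic_abs_minus [simp]: "padic_abs (- x :: 'a) = padic_abs x"
proof -
  have "padic_abs (- 1 :: 'a) ^ 2 = 1"
    using padic_abs_mult[of "- 1" "- 1"] by (simp add: power2_eq_square)
  then have "padic_abs (- 1 :: 'a) = 1"
    by (simp add: power2_eq_1_iff) (smt (verit) padic_abs_nonneg)
  then show ?thesis
    using padic_abs_mult[of "- 1" x] by simp
qed

lemma padic_abs_diff_le: "padic_abs (x - y :: 'a) \<le> max (padic_abs x) (padic_abs y)"
  using padic_abs_add_le[of x "- y"] by simp

lemma padic_abs_power: "padic_abs (x ^ n :: 'a) = padic_abs x ^ n"
  by (induction n) (simp_all add: padic_abs_mult)

lemma padic_abs_inverse: "padic_abs (inverse x :: 'a) = inverse (padic_abs x)"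
proof (cases "x = 0")
  case False
  then have "padic_abs (inverse x) * padic_abs x = 1"
    by (simp flip: padic_abs_mult)
  then show ?thesis
    using False by (simp add: field_simps)
qed simp

lemma padic_abs_divide: "padic_abs (x / y :: 'a) = padic_abs x / padic_abs y"
  by (simp add: divide_inverse padic_abs_mult padic_abs_inverse)

lemma padic_abs_prod: "padic_abs (prod f A :: 'a) = (\<Prod>i\<in>A. padic_abs (f i))"
  by (induction A rule: infinite_finite_induct) (simp_all add: padic_abs_mult)

lemma padic_abs_sum_le:
  assumes "\<And>i. i \<in> A \<Longrightarrow> padic_abs (f i :: 'a) \<le> M" and "M \<ge> 0"
  shows "padic_abs (sum f A) \<le> M"
  using assms(1)
proof (induction A rule: infinite_finite_induct)
  case (insert x A)
  then show ?case
    using padic_abs_add_le[of "f x" "sum f A"] by force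
qed (use assms(2) in simp_all)

lemma padic_abs_of_nat_le_1: "padic_abs (of_nat n :: 'a) \<le> 1"
proof (induction n)
  case (Suc n)
  then show ?case
    using padic_abs_add_le[of 1 "of_nat n"] by simp
qed simp

section \<open>Limits of sums and products\<close>

lemma tendsto_iff_padic_abs:
  "(f \<longlongrightarrow> (l :: 'a)) F \<longleftrightarrow> ((\<lambda>x. padic_abs (f x - l)) \<longlongrightarrow> 0) F"
  by (subst tendsto_dist_iff) (simp add: dist_eq)

lemma tendsto_if_padic_abs_le:
  assumes "\<And>x. padic_abs (f x - l :: 'a) \<le> g x" and "(g \<longlongrightarrow> 0) F"
  shows "(f \<longlongrightarrow> l) F"
  unfolding tendsto_iff_padic_abs
  by (rule tendsto_sandwich[OF _ _ tendsto_const assms(2)]) (simp_all add: assms(1))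

text \<open>The sort of \<open>'a\<close> links the metric to no field operation, so continuity of
  addition, and of multiplication below, has to be derived from the absolute value.\<close>

lemma padic_tendsto_add:
  assumes "(f \<longlongrightarrow> (a :: 'a)) F" "(g \<longlongrightarrow> b) F"
  shows "((\<lambda>x. f x + g x) \<longlongrightarrow> a + b) F"
proof (rule tendsto_if_padic_abs_le)
  show "padic_abs (f x + g x - (a + b)) \<le> padic_abs (f x - a) + padic_abs (g x - b)" for x
    using padic_abs_add_le[of "f x - a" "g x - b"]
    by (smt (verit) add_diff_add padic_abs_nonneg)
  show "((\<lambda>x. padic_abs (f x - a) + padic_abs (g x - b)) \<longlongrightarrow> 0) F"
    using assms tendsto_add_zero unfolding tendsto_iff_padic_abs by blast
qed

lemma padic_tendsto_mult:
  assumes "(f \<longlongrightarrow> (a :: 'a)) F" "(g \<longlongrightarrow> b) F"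
  shows "((\<lambda>x. f x * g x) \<longlongrightarrow> a * b) F"
proof (rule tendsto_if_padic_abs_le)
  fix x
  let ?u = "f x - a" and ?v = "g x - b"
  have "f x * g x - a * b = ?u * ?v + (a * ?v + ?u * b)"
    by (simp add: algebra_simps)
  also have "padic_abs \<dots> \<le> max (padic_abs (?u * ?v)) (max (padic_abs (a * ?v)) (padic_abs (?u * b)))"
    by (meson max.mono order.refl order.trans padic_abs_add_le)
  also have "\<dots> \<le> padic_abs ?u * padic_abs ?v + (padic_abs a * padic_abs ?v + padic_abs ?u * padic_abs b)"
    unfolding padic_abs_mult
    by (smt (verit) mult_nonneg_nonneg padic_abs_nonneg)
  finally show "padic_abs (f x * g x - a * b)
    \<le> padic_abs ?u * padic_abs ?v + (padic_abs a * padic_abs ?v + padic_abs ?u * padic_abs b)" .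
next
  have "((\<lambda>x. padic_abs (f x - a) * padic_abs (g x - b)
      + (padic_abs a * padic_abs (g x - b) + padic_abs (f x - a) * padic_abs b))
    \<longlongrightarrow> 0 * 0 + (padic_abs a * 0 + 0 * padic_abs b)) F"
    using assms unfolding tendsto_iff_padic_abs by (intro tendsto_intros)
  then show "((\<lambda>x. padic_abs (f x - a) * padic_abs (g x - b)
      + (padic_abs a * padic_abs (g x - b) + padic_abs (f x - a) * padic_abs b)) \<longlongrightarrow> 0) F"
    by simp
qed

lemma padic_tendsto_sum:
  assumes "\<And>i. i \<in> A \<Longrightarrow> (f i \<longlongrightarrow> (a i :: 'a)) F"
  shows "((\<lambda>x. \<Sum>i\<in>A. f i x) \<longlongrightarrow> sum a A) F"
  using assms by (induction A rule: infinite_finite_induct) (simp_all add: padic_tendsto_add)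

lemma padic_tendsto_prod:
  assumes "\<And>i. i \<in> A \<Longrightarrow> (f i \<longlongrightarrow> (a i :: 'a)) F"
  shows "((\<lambda>x. \<Prod>i\<in>A. f i x) \<longlongrightarrow> prod a A) F"
  using assms by (induction A rule: infinite_finite_induct) (simp_all add: padic_tendsto_mult)

section \<open>Power series with bounded Gauss norm\<close>

definition fps_value :: "'a fps \<Rightarrow> 'a \<Rightarrow> 'a" where
  "fps_value f t = (\<Sum>n. fps_nth f n * t ^ n)"

text \<open>For \<open>r > 0\<close> this says that the Gauss norm of radius \<open>r\<close> is at
  most \<open>M\<close>. The bound is kept explicit because composition needs the norm of the inner
  series.\<close>

definition gauss_bounded :: "real \<Rightarrow> real \<Rightarrow> 'a fps \<Rightarrow> bool" where
  "gauss_bounded r M f \<longleftrightarrow> (\<forall>n. padic_abs (fps_nth f n) * r ^ n \<le> M)"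

lemma gauss_boundedD: "gauss_bounded r M f \<Longrightarrow> padic_abs (fps_nth f n) * r ^ n \<le> M"
  by (simp add: gauss_bounded_def)

lemma gauss_bounded_nonneg: "gauss_bounded r M f \<Longrightarrow> M \<ge> 0"
  using gauss_boundedD[of r M f 0] order.trans[OF padic_abs_nonneg] by simp

lemma gauss_bounded_mono: "gauss_bounded r M f \<Longrightarrow> M \<le> N \<Longrightarrow> gauss_bounded r N f"
  unfolding gauss_bounded_def using order.trans by blast

lemma gauss_bounded_add:
  assumes "gauss_bounded r M f" "gauss_bounded r M g" "r \<ge> 0"
  shows "gauss_bounded r M (f + g)"
  unfolding gauss_bounded_def
proof
  fix n
  have "padic_abs (fps_nth (f + g) n) * r ^ n
    \<le> max (padic_abs (fps_nth f n)) (padic_abs (fps_nth g n)) * r ^ n"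
    using padic_abs_add_le \<open>r \<ge> 0\<close> by (intro mult_right_mono) simp_all
  also have "\<dots> \<le> M"
    using assms gauss_boundedD by (simp add: max_def)
  finally show "padic_abs (fps_nth (f + g) n) * r ^ n \<le> M" .
qed

lemma gauss_bounded_minus: "gauss_bounded r M f \<Longrightarrow> gauss_bounded r M (- f)"
  by (simp add: gauss_bounded_def)

lemma gauss_bounded_diff:
  "gauss_bounded r M f \<Longrightarrow> gauss_bounded r M g \<Longrightarrow> r \<ge> 0 \<Longrightarrow> gauss_bounded r M (f - g)"
  using gauss_bounded_add[of r M f "- g"] gauss_bounded_minus[of r M g] by simp

lemma gauss_bounded_0: "M \<ge> 0 \<Longrightarrow> gauss_bounded r M 0"
  by (simp add: gauss_bounded_def)

lemma gauss_bounded_sum: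
  assumes "\<And>i. i \<in> A \<Longrightarrow> gauss_bounded r M (f i)" "r \<ge> 0" "M \<ge> 0"
  shows "gauss_bounded r M (sum f A)"
  using assms by (induction A rule: infinite_finite_induct)
    (simp_all add: gauss_bounded_add gauss_bounded_0)

text \<open>Splitting \<open>r ^ n = r ^ i * r ^ (n - i)\<close> bounds each term of the
  convolution, and the ultrametric inequality passes that bound to the sum.\<close>

lemma gauss_bounded_mult:
  assumes "gauss_bounded r M f" "gauss_bounded r N g" "r > 0"
  shows "gauss_bounded r (M * N) (f * g)"
  unfolding gauss_bounded_def
proof
  fix n
  have MN: "M \<ge> 0" "N \<ge> 0"
    using assms gauss_bounded_nonneg by blast+
  have "padic_abs (\<Sum>i=0..n. fps_nth f i * fps_nth g (n - i)) \<le> M * N / r ^ n"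
  proof (rule padic_abs_sum_le)
    fix i assume "i \<in> {0..n}"
    then have "r ^ n = r ^ i * r ^ (n - i)"
      by (simp flip: power_add)
    then have "padic_abs (fps_nth f i * fps_nth g (n - i)) * r ^ n
      = (padic_abs (fps_nth f i) * r ^ i) * (padic_abs (fps_nth g (n - i)) * r ^ (n - i))"
      by (simp add: padic_abs_mult)
    also have "\<dots> \<le> M * N"
      using assms MN by (intro mult_mono gauss_boundedD) simp_all
    finally show "padic_abs (fps_nth f i * fps_nth g (n - i)) \<le> M * N / r ^ n"
      using \<open>r > 0\<close> by (simp add: field_simps)
  qed (use MN \<open>r > 0\<close> in simp)
  then show "padic_abs (fps_nth (f * g) n) * r ^ n \<le> M * N"
    using \<open>r > 0\<close> by (simp add: fps_mult_nth field_simps)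
qed

lemma gauss_bounded_const: "padic_abs c \<le> M \<Longrightarrow> gauss_bounded r M (fps_const c)"
  using order.trans[OF padic_abs_nonneg] by (auto simp: gauss_bounded_def)

lemma gauss_bounded_X: "r \<ge> 0 \<Longrightarrow> gauss_bounded r r fps_X"
  by (simp add: gauss_bounded_def fps_X_def)

lemma gauss_bounded_power:
  assumes "gauss_bounded r M f" "r > 0"
  shows "gauss_bounded r (M ^ k) (f ^ k)"
proof (induction k)
  case 0
  then show ?case
    using gauss_bounded_const[of 1 1] by simp
next
  case (Suc k)
  then show ?case
    using gauss_bounded_mult[OF assms(1) _ assms(2)] by simp
qed

text \<open>Strong induction on the recursion for the coefficients of the inverse; constant term 1
  means that the recursion divides by nothing and the bound 1 persists.\<close>

lemma gauss_bounded_inverse: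
  assumes "gauss_bounded r 1 f" "fps_nth f 0 = 1" "r > 0"
  shows "gauss_bounded r 1 (inverse f)"
  unfolding gauss_bounded_def
proof
  fix n
  show "padic_abs (fps_nth (inverse f) n) * r ^ n \<le> 1"
  proof (induction n rule: less_induct)
    case (less n)
    show ?case
    proof (cases "n = 0")
      case True
      then show ?thesis
        using assms(2) by simp
    next
      case False
      have "fps_nth (f * inverse f) n = 0"
        using assms(2) False inverse_mult_eq_1'[of f] by simp
      then have "fps_nth (inverse f) n = - (\<Sum>i=1..n. fps_nth f i * fps_nth (inverse f) (n - i))"
        using assms(2) by (simp add: fps_mult_nth sum.atLeast_Suc_atMost eq_neg_iff_add_eq_0)
      moreover have "padic_abs (\<Sum>i=1..n. fps_nth f i * fps_nth (inverse f) (n - i)) \<le> 1 / r ^ n"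
      proof (rule padic_abs_sum_le)
        fix i assume i: "i \<in> {1..n}"
        then have "r ^ n = r ^ i * r ^ (n - i)"
          by (simp flip: power_add)
        then have "padic_abs (fps_nth f i * fps_nth (inverse f) (n - i)) * r ^ n
          = (padic_abs (fps_nth f i) * r ^ i) * (padic_abs (fps_nth (inverse f) (n - i)) * r ^ (n - i))"
          by (simp add: padic_abs_mult)
        also have "\<dots> \<le> 1 * 1"
          using gauss_boundedD[OF assms(1)] \<open>r > 0\<close> i less.IH[of "n - i"]
          by (intro mult_mono) simp_all
        finally show "padic_abs (fps_nth f i * fps_nth (inverse f) (n - i)) \<le> 1 / r ^ n"
          using \<open>r > 0\<close> by (simp add: field_simps)
      qed (use \<open>r > 0\<close> in simp)
      ultimately show ?thesis
        using \<open>r > 0\<close> by (simp add: field_simps)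
    qed
  qed
qed

section \<open>Evaluation at a point of the open disc of radius \<open>r\<close>\<close>

context
  fixes r :: real and t :: 'a
  assumes t_less: "padic_abs t < r"
begin

lemma r_pos: "r > 0"
  using t_less padic_abs_nonneg[of t] by linarith

lemma gauss_bounded_term_le:
  assumes "gauss_bounded r M f" and "N \<le> n"
  shows "padic_abs (fps_nth f n * t ^ n) \<le> M * (padic_abs t / r) ^ N"
proof -
  have "padic_abs (fps_nth f n * t ^ n) = (padic_abs (fps_nth f n) * r ^ n) * (padic_abs t / r) ^ n"
    using r_pos by (simp add: padic_abs_mult padic_abs_power power_divide)
  also have "\<dots> \<le> M * (padic_abs t / r) ^ N"
    using assms gauss_boundedD gauss_bounded_nonneg r_pos t_less
    by (intro mult_mono power_decreasing) simp_all
  finally show ?thesis .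
qed

lemma geometric_bound_tendsto_0: "(\<lambda>N. M * (padic_abs t / r) ^ N) \<longlonglongrightarrow> 0"
  using t_less r_pos by (intro tendsto_mult_right_zero LIMSEQ_power_zero) simp

text \<open>In an ultrametric field a block of terms is no larger than its largest term, so
  geometric decay of the terms makes the partial sums Cauchy.\<close>

lemma fps_value_sums:
  assumes "gauss_bounded r M f"
  shows "(\<lambda>n. fps_nth f n * t ^ n) sums fps_value f t"
proof -
  let ?s = "\<lambda>n. \<Sum>i<n. fps_nth f i * t ^ i"
  have diff: "dist (?s m) (?s n) \<le> M * (padic_abs t / r) ^ N" if "N \<le> n" "n \<le> m" for N m n
  proof -
    have "?s m - ?s n = (\<Sum>i=n..<m. fps_nth f i * t ^ i)"
      using that sum_diff_nat_ivl[of 0 n m] by (simp add: atLeast0LessThan)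
    also have "padic_abs \<dots> \<le> M * (padic_abs t / r) ^ N"
      using that assms gauss_bounded_nonneg r_pos
      by (intro padic_abs_sum_le gauss_bounded_term_le) auto
    finally show ?thesis
      by (simp add: dist_eq)
  qed
  have "Cauchy ?s"
    unfolding Cauchy_altdef2
  proof (intro allI impI)
    fix e :: real assume "e > 0"
    then have "\<forall>\<^sub>F N in sequentially. M * (padic_abs t / r) ^ N < e"
      using geometric_bound_tendsto_0 order_tendstoD(2) by blast
    then obtain N where "M * (padic_abs t / r) ^ N < e"
      by (auto simp: eventually_sequentially)
    then show "\<exists>N. \<forall>n\<ge>N. dist (?s n) (?s N) < e"
      using diff[OF order.refl] order.strict_trans1 by blast
  qed
  then have "convergent ?s"
    by (rule Cauchy_convergent)
  then show ?thesis
    unfolding fps_value_def by (simp add: summable_sums summable_iff_convergent)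
qed

text \<open>All partial sums obey the bound, hence so does the limit. A high order of vanishing
  forces a small value, which turns formal approximation into convergence.\<close>

lemma fps_value_le:
  assumes "gauss_bounded r M f" and "\<And>n. n < N \<Longrightarrow> fps_nth f n = 0"
  shows "padic_abs (fps_value f t) \<le> M * (padic_abs t / r) ^ N"
proof -
  have "(\<lambda>n. \<Sum>i<n. fps_nth f i * t ^ i) \<longlonglongrightarrow> fps_value f t"
    using fps_value_sums[OF assms(1)] by (simp add: sums_def)
  then have "(\<lambda>n. dist (\<Sum>i<n. fps_nth f i * t ^ i) 0) \<longlonglongrightarrow> dist (fps_value f t) 0"
    by (intro tendsto_dist tendsto_const)
  moreover have "dist (\<Sum>i<n. fps_nth f i * t ^ i) 0 \<le> M * (padic_abs t / r) ^ N" for n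
    unfolding padic_abs_def[symmetric]
  proof (rule padic_abs_sum_le)
    show "padic_abs (fps_nth f i * t ^ i) \<le> M * (padic_abs t / r) ^ N" for i
      using assms gauss_bounded_term_le[of M f N i] gauss_bounded_nonneg r_pos
      by (cases "i < N") simp_all
  qed (use assms gauss_bounded_nonneg r_pos in simp)
  ultimately show ?thesis
    unfolding padic_abs_def by (intro Lim_bounded) auto
qed

lemma fps_value_add:
  assumes "gauss_bounded r M f" "gauss_bounded r N g"
  shows "fps_value (f + g) t = fps_value f t + fps_value g t"
proof -
  have "(\<lambda>n. fps_nth (f + g) n * t ^ n) sums (fps_value f t + fps_value g t)"
    using padic_tendsto_add[OF fps_value_sums[OF assms(1), unfolded sums_def]
        fps_value_sums[OF assms(2), unfolded sums_def]]
    by (simp add: sums_def sum.distrib ring_distribs)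
  then show ?thesis
    unfolding fps_value_def[of "f + g"] by (rule sums_unique[symmetric])
qed

lemma fps_value_const_mult:
  assumes "gauss_bounded r M f"
  shows "fps_value (fps_const c * f) t = c * fps_value f t"
proof -
  have "(\<lambda>n. fps_nth (fps_const c * f) n * t ^ n) sums (c * fps_value f t)"
    using padic_tendsto_mult[OF tendsto_const[of c] fps_value_sums[OF assms, unfolded sums_def]]
    by (simp add: sums_def sum_distrib_left mult.assoc)
  then show ?thesis
    unfolding fps_value_def[of "fps_const c * f"] by (rule sums_unique[symmetric])
qed

lemma fps_value_minus:
  "gauss_bounded r M f \<Longrightarrow> fps_value (- f) t = - fps_value f t"
  using fps_value_const_mult[of M f "- 1"] by (simp flip: fps_const_neg)

lemma fps_value_diff:
  "gauss_bounded r M f \<Longrightarrow> gauss_bounded r N g \<Longrightarrow> fps_value (f - g) t = fps_value f t - fps_value g t"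
  using fps_value_add[of M f N "- g"] fps_value_minus[of N g] gauss_bounded_minus[of r N g] by simp

lemma fps_value_const: "fps_value (fps_const c) t = c"
proof -
  have "(\<lambda>n. fps_nth (fps_const c) n * t ^ n) sums (\<Sum>n\<in>{0}. fps_nth (fps_const c) n * t ^ n)"
    by (rule sums_finite) auto
  then show ?thesis
    unfolding fps_value_def using sums_unique by fastforce
qed

lemma fps_value_sum:
  assumes "\<And>i. i \<in> A \<Longrightarrow> gauss_bounded r M (f i)" "M \<ge> 0"
  shows "fps_value (sum f A) t = (\<Sum>i\<in>A. fps_value (f i) t)"
  using assms(1)
proof (induction A rule: infinite_finite_induct)
  case (insert x A)
  then show ?case
    using fps_value_add[of M "f x" M "sum f A"] gauss_bounded_sum[of A r M f] r_pos assms(2)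
    by simp
qed (use fps_value_const[of 0] in simp_all)

text \<open>
  Both products and compositions are sums of series divisible by growing powers of the variable,
  so this lemma yields their evaluation.
\<close>

lemma fps_value_formal_sums:
  assumes bounded: "\<And>k. gauss_bounded r M (F k)"
    and low: "\<And>k n. n < k \<Longrightarrow> fps_nth (F k) n = 0"
    and H: "\<And>n. fps_nth H n = (\<Sum>k=0..n. fps_nth (F k) n)"
  shows "gauss_bounded r M H" and "(\<lambda>k. fps_value (F k) t) sums fps_value H t"
proof -
  have M: "M \<ge> 0"
    using bounded gauss_bounded_nonneg by blast
  have fin: "gauss_bounded r M (\<Sum>k<K. F k)" for K
    using bounded M r_pos by (intro gauss_bounded_sum) simp_all
  \<comment> \<open>Members from index \<open>K\<close> on do not reach degrees below
    \<open>K\<close>, so \<open>H\<close> agrees there with the \<open>K\<close>-th partial sum and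
    their difference vanishes to order \<open>K\<close>.\<close>
  have H': "fps_nth H n = fps_nth (\<Sum>k<K. F k) n" if "n < K" for n K
  proof -
    have "(\<Sum>k<K. fps_nth (F k) n) = (\<Sum>k=0..n. fps_nth (F k) n)"
      using that low by (intro sum.mono_neutral_right) auto
    then show ?thesis
      by (simp add: H fps_sum_nth)
  qed
  show HM: "gauss_bounded r M H"
    unfolding gauss_bounded_def
  proof
    show "padic_abs (fps_nth H n) * r ^ n \<le> M" for n
      using H'[of n "Suc n"] gauss_boundedD[OF fin, of "Suc n" n] by (simp only: lessI)
  qed
  show "(\<lambda>k. fps_value (F k) t) sums fps_value H t"
    unfolding sums_def
  proof (rule tendsto_if_padic_abs_le[OF _ geometric_bound_tendsto_0])
    fix K
    have "(\<Sum>k<K. fps_value (F k) t) - fps_value H t = fps_value ((\<Sum>k<K. F k) - H) t"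
      using fps_value_diff[OF fin HM] fps_value_sum[of "{..<K}" M F] bounded M by simp
    also have "padic_abs \<dots> \<le> M * (padic_abs t / r) ^ K"
      using H' fin HM r_pos by (intro fps_value_le gauss_bounded_diff) simp_all
    finally show "padic_abs ((\<Sum>k<K. fps_value (F k) t) - fps_value H t) \<le> M * (padic_abs t / r) ^ K" .
  qed
qed

lemma fps_value_X_mult:
  assumes "gauss_bounded r M f"
  shows "fps_value (fps_X * f) t = t * fps_value f t"
proof -
  have "(\<lambda>n. \<Sum>i<n. fps_nth (fps_X * f) i * t ^ i) \<longlonglongrightarrow> t * fps_value f t"
  \<comment> \<open>The constant term of \<open>fps_X * f\<close> is 0, so its partial sums are
    those of \<open>f\<close> times \<open>t\<close>, one index later.\<close>
  proof (rule LIMSEQ_imp_Suc)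
    have "(\<Sum>i<Suc n. fps_nth (fps_X * f) i * t ^ i) = t * (\<Sum>i<n. fps_nth f i * t ^ i)" for n
      by (simp only: sum.lessThan_Suc_shift) (simp add: sum_distrib_left mult_ac)
    then show "(\<lambda>n. \<Sum>i<Suc n. fps_nth (fps_X * f) i * t ^ i) \<longlonglongrightarrow> t * fps_value f t"
      using padic_tendsto_mult[OF tendsto_const[of t] fps_value_sums[OF assms, unfolded sums_def]]
      by simp
  qed
  then show ?thesis
    unfolding fps_value_def[of "fps_X * f"] sums_def[symmetric] by (rule sums_unique[symmetric])
qed

lemma fps_value_X_power_mult:
  assumes "gauss_bounded r M f"
  shows "fps_value (fps_X ^ k * f) t = t ^ k * fps_value f t"
proof (induction k)
  case (Suc k)
  have "gauss_bounded r (r ^ k * M) (fps_X ^ k * f)"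
    using assms r_pos by (intro gauss_bounded_mult gauss_bounded_power gauss_bounded_X) simp_all
  then show ?case
    using fps_value_X_mult Suc by (simp add: mult.assoc)
qed simp

text \<open>Expanding only \<open>f\<close> writes the product as the formal sum of the series
  \<open>f_k X^k g\<close>, each of which is evaluated by the preceding lemmas.\<close>

lemma fps_value_mult:
  assumes f: "gauss_bounded r M f" and g: "gauss_bounded r N g"
  shows "fps_value (f * g) t = fps_value f t * fps_value g t"
proof -
  define F where "F k = fps_const (fps_nth f k) * (fps_X ^ k * g)" for k
  have Xg: "gauss_bounded r (r ^ k * N) (fps_X ^ k * g)" for k
    using g r_pos by (intro gauss_bounded_mult gauss_bounded_power gauss_bounded_X) simp_all
  have "gauss_bounded r (M * N) (F k)" for k
  proof -
    have "gauss_bounded r (padic_abs (fps_nth f k) * (r ^ k * N)) (F k)"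
      unfolding F_def using gauss_bounded_mult[OF gauss_bounded_const[OF order.refl] Xg r_pos] .
    moreover have "padic_abs (fps_nth f k) * (r ^ k * N) \<le> M * N"
      using gauss_boundedD[OF f, of k] gauss_bounded_nonneg[OF g]
      by (simp add: mult_right_mono flip: mult.assoc)
    ultimately show ?thesis
      by (rule gauss_bounded_mono)
  qed
  moreover have "fps_nth (F k) n = 0" if "n < k" for k n
    using that by (simp add: F_def fps_X_power_mult_nth)
  moreover have "fps_nth (f * g) n = (\<Sum>k=0..n. fps_nth (F k) n)" for n
    by (simp add: F_def fps_X_power_mult_nth fps_mult_nth[of f g])
  ultimately have "(\<lambda>k. fps_value (F k) t) sums fps_value (f * g) t"
    by (rule fps_value_formal_sums(2))
  moreover have "fps_value (F k) t = fps_nth f k * t ^ k * fps_value g t" for k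
    using fps_value_const_mult[OF Xg] fps_value_X_power_mult[OF g] by (simp add: F_def)
  moreover have "(\<lambda>k. fps_nth f k * t ^ k * fps_value g t) sums (fps_value f t * fps_value g t)"
    using padic_tendsto_mult[OF fps_value_sums[OF f, unfolded sums_def] tendsto_const[of "fps_value g t"]]
    by (simp add: sums_def sum_distrib_right)
  ultimately show ?thesis
    using sums_unique2 by fastforce
qed

lemma fps_value_power:
  assumes "gauss_bounded r M f"
  shows "fps_value (f ^ k) t = fps_value f t ^ k"
proof (induction k)
  case 0
  then show ?case
    using fps_value_const[of 1] by simp
next
  case (Suc k)
  then show ?case
    using fps_value_mult[OF assms gauss_bounded_power[OF assms r_pos]] by simp
qed

text \<open>Since \<open>g\<close> has no constant term, \<open>g ^ k\<close> vanishes to order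
  \<open>k\<close>. The norm \<open>N\<close> of \<open>g\<close> is the radius at which the
  coefficients of \<open>f\<close> must be bounded.\<close>

lemma fps_value_compose:
  assumes g: "gauss_bounded r N g" and g0: "fps_nth g 0 = 0"
    and fg: "\<And>k. padic_abs (fps_nth f k) * N ^ k \<le> M"
  shows "gauss_bounded r M (f oo g)"
    and "(\<lambda>k. fps_nth f k * fps_value g t ^ k) sums fps_value (f oo g) t"
proof -
  define F where "F k = fps_const (fps_nth f k) * g ^ k" for k
  have gk: "gauss_bounded r (N ^ k) (g ^ k)" for k
    using gauss_bounded_power[OF g r_pos] .
  have 1: "gauss_bounded r M (F k)" for k
    using gauss_bounded_mult[OF gauss_bounded_const[OF order.refl] gk r_pos] fg gauss_bounded_mono
    unfolding F_def by blast
  have 2: "fps_nth (F k) n = 0" if "n < k" for k n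
    using that g0 by (simp add: F_def startsby_zero_power_prefix)
  have 3: "fps_nth (f oo g) n = (\<Sum>k=0..n. fps_nth (F k) n)" for n
    by (simp add: F_def fps_compose_nth)
  show "gauss_bounded r M (f oo g)"
    by (rule fps_value_formal_sums(1)[OF 1 2 3])
  have "fps_value (F k) t = fps_nth f k * fps_value g t ^ k" for k
    using fps_value_const_mult[OF gk] fps_value_power[OF g] by (simp add: F_def)
  then show "(\<lambda>k. fps_nth f k * fps_value g t ^ k) sums fps_value (f oo g) t"
    using fps_value_formal_sums(2)[OF 1 2 3] by simp
qed

end

end

section \<open>Formal generating functions\<close>

text \<open>Both sides solve \<open>(1 + X) F' = c F\<close> with \<open>F(0) = 1\<close>. This
  reduces binomial series to the exponential and the logarithm.\<close>

lemma fps_binomial_conv_compose: "fps_binomial (c :: 'a::field_char_0) = fps_exp c oo fps_ln 1"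
proof -
  have "fps_deriv (fps_exp c oo fps_ln 1) = fps_const c * (fps_exp c oo fps_ln 1) / (1 + fps_X)"
    by (simp add: fps_compose_deriv fps_ln_deriv fps_divide_unit mult.assoc
        flip: fps_const_mult_apply_left)
  then show ?thesis
    using fps_binomial_ODE_unique'[of "fps_exp c oo fps_ln 1" c] by simp
qed

text \<open>
  With \<open>\<mu> = 1 / \<lambda>\<close> this is \<open>\<mu> log (1 + t) / ((1 + t)^\<mu> - 1)\<close>, the generating function of
  \<open>\<beta>\<^sub>n\<^sub>,\<^sub>\<lambda> / (\<lambda>^n n!)\<close>; numerator and denominator are both divided by \<open>t\<close>
  so that the denominator becomes a unit.
\<close>

definition bernoulli_gf :: "'a::field_char_0 \<Rightarrow> 'a fps" where
  "bernoulli_gf \<mu> = fps_shift 1 (fps_const \<mu> * fps_ln 1) * inverse (fps_shift 1 (fps_binomial \<mu> - 1))"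

lemma bernoulli_gf_mult:
  assumes "\<mu> \<noteq> 0"
  shows "bernoulli_gf \<mu> * (fps_binomial \<mu> - 1) = fps_const \<mu> * fps_ln 1"
proof -
  let ?W = "fps_shift 1 (fps_binomial \<mu> - 1)" and ?L = "fps_const \<mu> * fps_ln 1"
  have W: "fps_binomial \<mu> - 1 = fps_X * ?W" and L: "?L = fps_X * fps_shift 1 ?L"
    by (simp_all add: fps_eq_iff)
  have "bernoulli_gf \<mu> * (fps_binomial \<mu> - 1) = bernoulli_gf \<mu> * (fps_X * ?W)"
    by (rule arg_cong[OF W])
  also have "\<dots> = (fps_X * fps_shift 1 ?L) * (inverse ?W * ?W)"
    unfolding bernoulli_gf_def by (simp only: mult_ac)
  also have "inverse ?W * ?W = 1"
    using assms by (intro inverse_mult_eq_1) simp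
  finally show ?thesis
    by (simp only: L[symmetric] mult_1_right)
qed

lemma fps_binomial_minus_mult: "fps_binomial \<mu> * fps_binomial (- \<mu>) = 1"
  using fps_binomial_add_mult[of \<mu> "- \<mu>"] by simp

text \<open>From \<open>B(\<mu>) B(- \<mu>) = 1\<close> follows
  \<open>B(\<mu>) - 1 = - (B(- \<mu>) - 1) B(\<mu>)\<close>, where \<open>B\<close> is
  \<open>fps_binomial\<close>; so both generating functions get the same denominator.\<close>

lemma bernoulli_gf_minus_mult:
  assumes "\<mu> \<noteq> 0"
  shows "bernoulli_gf (- \<mu>) * (fps_binomial \<mu> - 1) = fps_const \<mu> * fps_ln 1 * fps_binomial \<mu>"
proof -
  have "bernoulli_gf (- \<mu>) * (fps_binomial \<mu> - 1)
      = - (bernoulli_gf (- \<mu>) * (fps_binomial (- \<mu>) - 1)) * fps_binomial \<mu>"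
    using fps_binomial_minus_mult[of \<mu>] by (simp add: algebra_simps)
  also have "\<dots> = fps_const \<mu> * fps_ln 1 * fps_binomial \<mu>"
    using assms by (simp add: bernoulli_gf_mult flip: fps_const_neg)
  finally show ?thesis .
qed

lemma fps_binomial_neq_1: "\<mu> \<noteq> 0 \<Longrightarrow> fps_binomial \<mu> - 1 \<noteq> (0 :: 'a::field_char_0 fps)"
  by (auto simp: fps_eq_iff intro!: exI[of _ 1])

text \<open>Over the common denominator the numerators differ by the factor
  \<open>fps_binomial \<mu>\<close>, so subtraction leaves a multiple of the denominator
  itself.\<close>

lemma bernoulli_gf_diff:
  assumes "\<mu> \<noteq> 0"
  shows "bernoulli_gf \<mu> - bernoulli_gf (- \<mu>) = - (fps_const \<mu> * fps_ln 1)"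
proof -
  have "(bernoulli_gf \<mu> - bernoulli_gf (- \<mu>)) * (fps_binomial \<mu> - 1)
      = - (fps_const \<mu> * fps_ln 1) * (fps_binomial \<mu> - 1)"
    unfolding left_diff_distrib bernoulli_gf_mult[OF assms] bernoulli_gf_minus_mult[OF assms]
    by (simp add: algebra_simps)
  then show ?thesis
    using fps_binomial_neq_1[OF assms] mult_right_cancel by blast
qed

text \<open>The division is exact because the linear coefficient of \<open>fps_ln 1\<close> is 1, so
  its order is at most that of \<open>fps_X\<close>.\<close>

lemma fps_X_div_fps_ln_mult: "fps_X / fps_ln 1 * fps_ln 1 = (fps_X :: 'a::field_char_0 fps)"
proof (rule dvd_div_mult_self)
  have ln1: "fps_nth (fps_ln 1) 1 = (1 :: 'a)"
    by (simp add: fps_ln_nth)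
  then have "fps_ln 1 \<noteq> (0 :: 'a fps)"
    by (metis fps_zero_nth zero_neq_one)
  then show "fps_ln 1 dvd (fps_X :: 'a fps)"
    using ln1 subdegree_leI[of "fps_ln (1 :: 'a)" 1] by (simp add: fps_dvd_iff)
qed

text \<open>Over the common denominator the sum of the generating functions is
  \<open>\<mu> log (1 + X) (B + 1) / (B - 1)\<close> with \<open>B = fps_binomial \<mu>\<close>. The
  Cauchy factor replaces the logarithm by \<open>X\<close>, and cancelling the square root of
  \<open>B\<close> makes the quotient symmetric.\<close>

lemma coth_gf:
  fixes \<mu> :: "'a::field_char_0"
  assumes "\<mu> \<noteq> 0"
  defines "T \<equiv> fps_const (1 / 2) * (bernoulli_gf \<mu> + bernoulli_gf (- \<mu>)) * (fps_X / fps_ln 1)"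
  shows "T * (fps_binomial (\<mu> / 2) - fps_binomial (- (\<mu> / 2)))
    = fps_const (\<mu> / 2) * fps_X * (fps_binomial (\<mu> / 2) + fps_binomial (- (\<mu> / 2)))"
proof -
  let ?h = "fps_binomial (\<mu> / 2)" and ?h' = "fps_binomial (- (\<mu> / 2))" and ?B = "fps_binomial \<mu>"
  have B: "?B = ?h * ?h" and hh: "?h * ?h' = 1"
    using fps_binomial_add_mult[of "\<mu> / 2" "\<mu> / 2"] fps_binomial_minus_mult[of "\<mu> / 2"] by simp_all
  have "T * (?B - 1) = fps_const (1 / 2) * (fps_X / fps_ln 1)
      * (bernoulli_gf \<mu> * (?B - 1) + bernoulli_gf (- \<mu>) * (?B - 1))"
    unfolding T_def by (simp add: algebra_simps)
  also have "\<dots> = (fps_const (1 / 2) * fps_const \<mu>) * (fps_X / fps_ln 1 * fps_ln 1) * (?B + 1)"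
    unfolding bernoulli_gf_mult[OF assms(1)] bernoulli_gf_minus_mult[OF assms(1)]
    by (simp only: algebra_simps mult_1_left)
  also have "\<dots> = fps_const (\<mu> / 2) * fps_X * (?B + 1)"
    by (simp only: fps_X_div_fps_ln_mult) simp
  finally have *: "T * (?B - 1) = fps_const (\<mu> / 2) * fps_X * (?B + 1)" .
  have "?B - 1 = ?h * (?h - ?h')" "?B + 1 = ?h * (?h + ?h')"
    by (simp_all add: B ring_distribs hh)
  with * have "?h * (T * (?h - ?h')) = ?h * (fps_const (\<mu> / 2) * fps_X * (?h + ?h'))"
    by (simp add: mult_ac)
  moreover have "?h \<noteq> 0"
    using hh by auto
  ultimately show ?thesis
    by simp
qed

lemma deg_falling_conv_gbinomial:
  assumes "lam \<noteq> 0"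
  shows "deg_falling lam x n = fact n * lam ^ n * ((x / lam) gchoose n)"
proof -
  have "deg_falling lam x n = (\<Prod>i<n. lam * (x / lam - of_nat i))"
    unfolding deg_falling_def using assms by (intro prod.cong) (simp_all add: field_simps)
  then show ?thesis
    by (simp add: gbinomial_prod_rev prod.distrib atLeast0LessThan)
qed

section \<open>Evaluation over a \<open>p\<close>-adic field\<close>

locale padic_field = ultrametric_field T for T :: "'a::{field_char_0, complete_space} itself" +
  fixes p :: nat
  assumes prime_p: "prime p"
    and padic_abs_p: "padic_abs (of_nat p :: 'a) = 1 / real p"
begin

section \<open>Absolute values of integers and factorials\<close>

lemma p_gt_1: "p > 1"
  using prime_p prime_gt_1_nat by blast

text \<open>Otherwise a Bezout relation \<open>m * x - p * y = 1\<close> would write 1 as a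
  difference of two elements of absolute value below 1.\<close>

lemma padic_abs_of_nat_eq_1:
  assumes "\<not> p dvd m"
  shows "padic_abs (of_nat m :: 'a) = 1"
proof (rule ccontr)
  assume "padic_abs (of_nat m :: 'a) \<noteq> 1"
  then have m: "padic_abs (of_nat m :: 'a) < 1"
    using padic_abs_of_nat_le_1[of m] by simp
  have "coprime m p"
    using assms prime_p prime_imp_coprime_nat coprime_commute by blast
  moreover have "m \<noteq> 0"
    using assms by (intro notI) simp
  ultimately obtain x y where "m * x = p * y + 1"
    using bezout_nat[of m p] by auto
  then have "of_nat (m * x) - of_nat (p * y) = (1 :: 'a)"
    by simp
  then have "1 \<le> max (padic_abs (of_nat (m * x) :: 'a)) (padic_abs (of_nat (p * y) :: 'a))"
    using padic_abs_diff_le padic_abs_1 by metis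
  moreover have "padic_abs (of_nat (k * z) :: 'a) < 1" if "padic_abs (of_nat k :: 'a) < 1" for k z
    using that padic_abs_of_nat_le_1[of z] mult_left_mono[of "padic_abs (of_nat z :: 'a)" 1 "padic_abs (of_nat k :: 'a)"]
    by (simp add: padic_abs_mult)
  ultimately show False
    using m padic_abs_p p_gt_1 by (smt (verit) less_imp_of_nat_less of_nat_1 divide_less_eq_1)
qed

text \<open>This is the radius of \<open>E_disc p\<close>; the estimates of factorials use it
  through \<open>rad ^ (p - 1) = 1 / p\<close>.\<close>

definition rad :: real where
  "rad = real p powr (- 1 / (real p - 1))"

lemma rad_pos: "rad > 0"
  using p_gt_1 by (simp add: rad_def)

lemma rad_power: "rad ^ (p - 1) = 1 / real p"
proof -
  have "rad ^ (p - 1) = real p powr (real (p - 1) * (- 1 / (real p - 1)))"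
    unfolding rad_def using p_gt_1 by (subst powr_power) simp_all
  also have "real (p - 1) * (- 1 / (real p - 1)) = - 1"
    using p_gt_1 by (simp add: of_nat_diff)
  finally show ?thesis
    using p_gt_1 by (simp add: powr_minus divide_inverse)
qed

lemma rad_le_1: "rad \<le> 1"
  unfolding rad_def using p_gt_1 powr_mono[of "- 1 / (real p - 1)" 0 "real p"] by simp

lemma padic_abs_fact_add:
  assumes "s < p"
  shows "padic_abs (fact (p * q + s) :: 'a) = padic_abs (fact (p * q) :: 'a)"
  using assms
proof (induction s)
  case (Suc s)
  have "\<not> p dvd p * q + Suc s"
    using Suc.prems by (simp add: dvd_add_right_iff nat_dvd_not_less del: add_Suc_right)
  then have "padic_abs (of_nat (p * q + Suc s) :: 'a) = 1"
    by (rule padic_abs_of_nat_eq_1)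
  moreover have "fact (p * q + Suc s) = (of_nat (p * q + Suc s) * fact (p * q + s) :: 'a)"
    by (metis add_Suc_right fact_Suc)
  ultimately show ?case
    using Suc by (simp add: padic_abs_mult)
qed simp

text \<open>Among the factors from \<open>p * q + 1\<close> to \<open>p * q + p\<close> only the
  last is divisible by \<open>p\<close>, and it contributes \<open>p * (q + 1)\<close>.\<close>

lemma padic_abs_fact_mult: "padic_abs (fact (p * q) :: 'a) = (1 / real p) ^ q * padic_abs (fact q :: 'a)"
proof (induction q)
  case (Suc q)
  have *: "p * Suc q = Suc (p * q + (p - 1))"
    using p_gt_1 by simp
  have "fact (p * Suc q) = (of_nat (p * Suc q) * fact (p * q + (p - 1)) :: 'a)"
    unfolding * fact_Suc ..
  then have "padic_abs (fact (p * Suc q) :: 'a)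
      = padic_abs (of_nat p :: 'a) * padic_abs (of_nat (Suc q) :: 'a) * padic_abs (fact (p * q) :: 'a)"
    using padic_abs_fact_add[of "p - 1" q] p_gt_1 by (simp only: padic_abs_mult of_nat_mult)
  then show ?case
    by (simp add: Suc padic_abs_p padic_abs_mult del: of_nat_Suc mult_Suc_right)
qed simp

text \<open>A form of Legendre's bound \<open>v(n!) \<le> (n - 1) / (p - 1)\<close>, by induction
  along \<open>n div p\<close>. The exponents match because
  \<open>(p - 1) q + (q - 1) = p q - 1\<close> for positive \<open>q\<close>; for
  \<open>n = 0\<close> the truncated exponent is 0.\<close>

lemma padic_abs_fact_ge: "padic_abs (fact n :: 'a) \<ge> rad ^ (n - 1)"
proof (induction n rule: less_induct)
  case (less n)
  define q where "q = n div p"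
  have n: "n = p * q + n mod p"
    by (simp add: q_def)
  have fact_n: "padic_abs (fact n :: 'a) = (1 / real p) ^ q * padic_abs (fact q :: 'a)"
    using n padic_abs_fact_add[of "n mod p" q] padic_abs_fact_mult[of q] p_gt_1 by simp
  show ?case
  proof (cases "q = 0")
    case True
    then show ?thesis
      using fact_n rad_pos rad_le_1 by (simp add: power_le_one)
  next
    case False
    then have "q < n"
      unfolding q_def using p_gt_1 by (intro div_less_dividend) (auto intro: gr0I)
    have "(p - 1) * q + (q - 1) = p * q - 1"
      using False p_gt_1 by (cases p; cases q) simp_all
    then have "rad ^ (p * q - 1) = (1 / real p) ^ q * rad ^ (q - 1)"
      by (metis power_add power_mult rad_power)
    also have "\<dots> \<le> padic_abs (fact n :: 'a)"
      using less.IH[OF \<open>q < n\<close>] fact_n by (simp add: divide_right_mono power_divide)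
    finally have "rad ^ (p * q - 1) \<le> padic_abs (fact n :: 'a)" .
    moreover have "rad ^ (n - 1) \<le> rad ^ (p * q - 1)"
      using n rad_pos rad_le_1 by (intro power_decreasing) linarith+
    ultimately show ?thesis
      by linarith
  qed
qed

lemma padic_abs_of_nat_ge:
  assumes "n > 0"
  shows "padic_abs (of_nat n :: 'a) \<ge> rad ^ (n - 1)"
proof -
  have "fact n = (of_nat n * of_nat (fact (n - 1)) :: 'a)"
    using assms by (simp add: fact_reduce)
  then have "padic_abs (fact n :: 'a) \<le> padic_abs (of_nat n :: 'a) * 1"
    using padic_abs_of_nat_le_1 by (metis mult_left_mono padic_abs_mult padic_abs_nonneg)
  then show ?thesis
    using padic_abs_fact_ge[of n] by simp
qed

section \<open>Logarithm, exponential, binomial series and hyperbolic cotangent on the disc\<close>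

lemma gauss_bounded_ln: "gauss_bounded rad rad (fps_ln 1)"
  unfolding gauss_bounded_def
proof
  fix n
  show "padic_abs (fps_nth (fps_ln 1) n :: 'a) * rad ^ n \<le> rad"
  proof (cases n)
    case 0
    then show ?thesis
      using rad_pos by simp
  next
    case (Suc m)
    then show ?thesis
      \<comment> \<open>The quotient \<open>rad ^ n / rad ^ (n - 1)\<close> gives the bound
        \<open>rad\<close> rather than 1, just what composition with the exponential
        requires.\<close>
      using padic_abs_of_nat_ge[of n] rad_pos
      by (simp add: fps_ln_nth padic_abs_divide padic_abs_power field_simps del: of_nat_Suc)
  qed
qed

lemma padic_abs_exp_coeff_le:
  assumes "padic_abs (y :: 'a) \<le> 1"
  shows "padic_abs (fps_nth (fps_exp y) k) * rad ^ k \<le> 1"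
proof -
  have "rad ^ k \<le> rad ^ (k - 1)"
    using rad_pos rad_le_1 by (intro power_decreasing) simp_all
  then have "padic_abs y ^ k * rad ^ k \<le> 1 * padic_abs (fact k :: 'a)"
    using padic_abs_fact_ge[of k] assms rad_pos by (intro mult_mono power_le_one) simp_all
  then show ?thesis
    by (simp add: padic_abs_divide padic_abs_power divide_le_eq)
qed

lemma gauss_bounded_binomial:
  assumes "padic_abs (y :: 'a) \<le> 1"
  shows "gauss_bounded rad 1 (fps_binomial y)"
  unfolding fps_binomial_conv_compose
  \<comment> \<open>The bound on the composite does not involve the evaluation point, so 0 serves as
    a point of the disc.\<close>
  using fps_value_compose(1)[of 0 rad rad "fps_ln 1"] gauss_bounded_ln rad_pos
    padic_abs_exp_coeff_le[OF assms] by simp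

lemma padic_log_conv_fps_value:
  assumes "padic_abs (t :: 'a) < rad"
  shows "padic_log (1 + t) = fps_value (fps_ln 1) t"
proof -
  have "(\<lambda>n. \<Sum>i<Suc n. fps_nth (fps_ln 1) i * t ^ i) \<longlonglongrightarrow> fps_value (fps_ln 1) t"
    using fps_value_sums[OF assms gauss_bounded_ln] unfolding sums_def by (rule LIMSEQ_Suc)
  then have "(\<lambda>n. (- 1) ^ n * t ^ Suc n / of_nat (Suc n)) sums fps_value (fps_ln 1) t"
    unfolding sum.lessThan_Suc_shift by (simp add: sums_def fps_ln_nth del: of_nat_Suc)
  then show ?thesis
    unfolding padic_log_def add_diff_cancel_left' by (rule sums_unique[symmetric])
qed

lemma padic_exp_log:
  assumes "padic_abs (t :: 'a) < rad" and "padic_abs y \<le> 1"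
  shows "padic_exp (y * padic_log (1 + t)) = fps_value (fps_binomial y) t"
proof -
  have "(\<lambda>k. fps_nth (fps_exp y) k * fps_value (fps_ln 1) t ^ k) sums fps_value (fps_binomial y) t"
    unfolding fps_binomial_conv_compose
    using fps_value_compose(2)[OF assms(1) gauss_bounded_ln fps_ln_0 padic_abs_exp_coeff_le[OF assms(2)]] .
  then show ?thesis
    unfolding padic_exp_def padic_log_conv_fps_value[OF assms(1)]
    by (intro sums_unique[symmetric]) (simp add: power_mult_distrib)
qed

text \<open>Keeping the factor \<open>y\<close> of the falling product gives the bound
  \<open>padic_abs y\<close> instead of 1; this allows the later division by
  \<open>2 * y\<close>.\<close>

lemma padic_abs_gbinomial_Suc_le:
  assumes "padic_abs (y :: 'a) \<le> 1"
  shows "padic_abs (y gchoose Suc n) * rad ^ n \<le> padic_abs y"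
proof -
  have le1: "padic_abs (y - of_nat i) \<le> 1" for i
    using padic_abs_diff_le[of y "of_nat i"] padic_abs_of_nat_le_1[of i] assms by simp
  have "padic_abs (y gchoose Suc n)
      = padic_abs y * (\<Prod>i=1..<Suc n. padic_abs (y - of_nat i)) / padic_abs (fact (Suc n) :: 'a)"
    unfolding gbinomial_prod_rev
    by (simp add: padic_abs_divide padic_abs_prod padic_abs_mult prod.atLeast_Suc_lessThan
        del: fact_Suc prod.op_ivl_Suc)
  also have "\<dots> \<le> padic_abs y * 1 / padic_abs (fact (Suc n) :: 'a)"
    using le1 by (intro divide_right_mono mult_left_mono prod_le_1) simp_all
  finally have "padic_abs (y gchoose Suc n) * padic_abs (fact (Suc n) :: 'a) \<le> padic_abs y"
    by (simp add: field_simps del: fact_Suc)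
  moreover have "padic_abs (y gchoose Suc n) * rad ^ n
      \<le> padic_abs (y gchoose Suc n) * padic_abs (fact (Suc n) :: 'a)"
    using padic_abs_fact_ge[of "Suc n"] by (intro mult_left_mono) simp_all
  ultimately show ?thesis
    by linarith
qed

text \<open>The difference of the binomial series is \<open>2 y X V\<close> with \<open>V\<close> of
  norm at most 1 and constant term 1. Hence \<open>H = S / (2 V)\<close> is bounded, and the
  identity for \<open>H\<close> can be evaluated at \<open>t\<close>.\<close>

lemma coth_sums:
  fixes y t :: 'a
  assumes two: "padic_abs (2 :: 'a) = 1"
    and y: "y \<noteq> 0" "padic_abs y \<le> 1" and t: "t \<noteq> 0" "padic_abs t < rad"
    and H: "H * (fps_binomial y - fps_binomial (- y))
      = fps_const y * fps_X * (fps_binomial y + fps_binomial (- y))"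
  shows "(\<lambda>n. fps_nth H n * t ^ n) sums
    (y * t * ((fps_value (fps_binomial y) t + fps_value (fps_binomial (- y)) t)
      / (fps_value (fps_binomial y) t - fps_value (fps_binomial (- y)) t)))"
proof -
  define D where "D = fps_binomial y - fps_binomial (- y)"
  define S where "S = fps_binomial y + fps_binomial (- y)"
  define V where "V = fps_const (1 / (2 * y)) * fps_shift 1 D"
  have D: "D = fps_const (2 * y) * (fps_X * V)"
    using y by (simp add: fps_eq_iff V_def D_def)
  have By: "gauss_bounded rad 1 (fps_binomial y)" "gauss_bounded rad 1 (fps_binomial (- y))"
    using y gauss_bounded_binomial[of y] gauss_bounded_binomial[of "- y"] by simp_all
  then have S_bounded: "gauss_bounded rad 1 S"
    using rad_pos by (simp add: S_def gauss_bounded_add)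
  have V: "gauss_bounded rad 1 V"
    unfolding gauss_bounded_def
  proof
    fix n
    have "padic_abs ((y gchoose Suc n) - (- y gchoose Suc n)) * rad ^ n
      \<le> max (padic_abs (y gchoose Suc n)) (padic_abs (- y gchoose Suc n)) * rad ^ n"
      using rad_pos by (intro mult_right_mono padic_abs_diff_le) simp
    also have "\<dots> \<le> padic_abs y"
      using padic_abs_gbinomial_Suc_le[of y n] padic_abs_gbinomial_Suc_le[of "- y" n] y
      by (simp add: max_def)
    finally show "padic_abs (fps_nth V n) * rad ^ n \<le> 1"
      using y two by (simp add: V_def D_def padic_abs_mult padic_abs_divide divide_le_eq)
  qed
  have V0: "fps_nth V 0 = 1"
    using y by (simp add: V_def D_def)
  have inv: "gauss_bounded rad 1 (inverse V)"
    using V V0 rad_pos by (rule gauss_bounded_inverse)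
  have "fps_const y * fps_X * (H * V * fps_const 2) = fps_const y * fps_X * S"
    using H unfolding D_def[symmetric] S_def[symmetric] D
    by (simp add: mult_ac flip: fps_const_mult)
  then have HV: "H * V * fps_const 2 = S"
    using y by simp
  have "fps_const (1 / 2) * (H * V * fps_const 2) * inverse V
      = (fps_const (1 / 2) * fps_const 2) * H * (V * inverse V)"
    by (simp only: mult_ac)
  also have "\<dots> = H"
    using V0 by (subst inverse_mult_eq_1') simp_all
  finally have "H = fps_const (1 / 2) * (S * inverse V)"
    unfolding HV by (simp only: mult.assoc)
  then have H_bounded: "gauss_bounded rad 1 H"
    using gauss_bounded_mult[OF gauss_bounded_const[of "1 / 2" 1] gauss_bounded_mult[OF S_bounded inv rad_pos] rad_pos]
      two by (simp add: padic_abs_divide)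
  \<comment> \<open>Evaluating \<open>V * inverse V = 1\<close> shows that the denominator of the
    cotangent is nonzero at \<open>t\<close>.\<close>
  have "fps_value V t * fps_value (inverse V) t = 1"
    using fps_value_mult[OF t(2) V inv] V0 inverse_mult_eq_1'[of V] fps_value_const[OF t(2), of 1] by simp
  then have Vt: "fps_value V t \<noteq> 0"
    by auto
  have XV: "gauss_bounded rad (rad * 1) (fps_X * V)"
    using V rad_pos by (intro gauss_bounded_mult gauss_bounded_X) simp_all
  have "fps_value (fps_binomial y) t - fps_value (fps_binomial (- y)) t = fps_value D t"
    using fps_value_diff[OF t(2) By] by (simp add: D_def)
  also have "\<dots> = 2 * y * t * fps_value V t"
    unfolding D fps_value_const_mult[OF t(2) XV] fps_value_X_mult[OF t(2) V] by simp
  finally have sinh: "fps_value (fps_binomial y) t - fps_value (fps_binomial (- y)) t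
    = 2 * y * t * fps_value V t" .
  have "fps_value (fps_binomial y) t + fps_value (fps_binomial (- y)) t = fps_value S t"
    using fps_value_add[OF t(2) By] by (simp add: S_def)
  also have "\<dots> = fps_value (fps_const 2 * (H * V)) t"
    by (simp add: HV[symmetric] mult_ac)
  also have "\<dots> = 2 * (fps_value H t * fps_value V t)"
    using fps_value_const_mult[OF t(2) gauss_bounded_mult[OF H_bounded V rad_pos]]
      fps_value_mult[OF t(2) H_bounded V] by simp
  finally have "fps_value H t = y * t * ((fps_value (fps_binomial y) t + fps_value (fps_binomial (- y)) t)
      / (fps_value (fps_binomial y) t - fps_value (fps_binomial (- y)) t))"
    unfolding sinh using y t Vt by (simp add: field_simps)
  then show ?thesis
    using fps_value_sums[OF t(2) H_bounded] by simp
qed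

section \<open>Volkenborn integrals of binomial coefficients\<close>

lemma power_p_tendsto_0: "(\<lambda>N. of_nat p ^ N :: 'a) \<longlonglongrightarrow> 0"
  using p_gt_1 by (simp add: tendsto_iff_padic_abs padic_abs_power padic_abs_p LIMSEQ_power_zero)

text \<open>Absorption extracts the factor \<open>p ^ N * \<mu> / (i + 1)\<close>, and what remains
  tends to \<open>-1 gchoose i\<close>. The limits are the coefficients of
  \<open>\<mu> log (1 + X) / X\<close>.\<close>

lemma gbinomial_power_p_tendsto:
  "(\<lambda>N. (of_nat (p ^ N) * \<mu> gchoose Suc i) / of_nat p ^ N) \<longlonglongrightarrow> \<mu> * ((- 1) ^ i / of_nat (Suc i) :: 'a)"
proof -
  have "(\<lambda>N. of_nat p ^ N * \<mu> - 1) \<longlonglongrightarrow> - 1"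
    using padic_tendsto_add[OF padic_tendsto_mult[OF power_p_tendsto_0 tendsto_const[of \<mu>]] tendsto_const[of "- 1"]]
    by simp
  then have "(\<lambda>N. of_nat p ^ N * \<mu> - 1 - of_nat j) \<longlonglongrightarrow> - 1 - of_nat j" for j
    using padic_tendsto_add[OF _ tendsto_const[of "- of_nat j"]] by fastforce
  then have "(\<lambda>N. (\<mu> / (of_nat (Suc i) * fact i)) * (\<Prod>j=0..<i. of_nat p ^ N * \<mu> - 1 - of_nat j))
    \<longlonglongrightarrow> (\<mu> / (of_nat (Suc i) * fact i)) * (\<Prod>j=0..<i. - 1 - of_nat j)"
    by (intro padic_tendsto_mult padic_tendsto_prod tendsto_const)
  moreover have "(\<mu> / (of_nat (Suc i) * fact i)) * (\<Prod>j=0..<i. c - of_nat j)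
      = \<mu> / of_nat (Suc i) * (c gchoose i)" for c
    by (simp add: gbinomial_prod_rev del: of_nat_Suc)
  ultimately have "(\<lambda>N. \<mu> / of_nat (Suc i) * (of_nat p ^ N * \<mu> - 1 gchoose i))
      \<longlonglongrightarrow> \<mu> / of_nat (Suc i) * (- 1 gchoose i)"
    by simp
  moreover have "(- 1 gchoose i) = ((- 1) ^ i :: 'a)"
    using gbinomial_minus[of "1 :: 'a" i] binomial_gbinomial[of i i, where ?'a = 'a] by simp
  moreover have "(of_nat (p ^ N) * \<mu> gchoose Suc i) / of_nat p ^ N
      = \<mu> / of_nat (Suc i) * (of_nat p ^ N * \<mu> - 1 gchoose i)" for N
    using gbinomial_absorption[of i "of_nat (p ^ N) * \<mu>"] p_gt_1
    by (simp add: field_simps del: of_nat_Suc)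
  ultimately show ?thesis
    by simp
qed

text \<open>
  The geometric sum \<open>((1 + t)^(M \<mu>) - 1) / ((1 + t)^\<mu> - 1)\<close> of the series \<open>(1 + t)^(x \<mu>)\<close>, \<open>x < M\<close>,
  reduces the integral to the derivative of \<open>(1 + t)^(x \<mu>)\<close> at \<open>x = 0\<close>.
\<close>

lemma gbinomial_volkenborn_tendsto:
  assumes "\<mu> \<noteq> (0 :: 'a)"
  shows "(\<lambda>N. (\<Sum>x = 0..<p ^ N. (of_nat x * \<mu> gchoose n)) / of_nat p ^ N) \<longlonglongrightarrow> fps_nth (bernoulli_gf \<mu>) n"
proof -
  let ?W = "fps_shift 1 (fps_binomial \<mu> - 1)"
  have W: "inverse ?W * ?W = 1"
    using assms by (intro inverse_mult_eq_1) simp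
  have sum: "(\<Sum>x = 0..<M. (of_nat x * \<mu> gchoose n))
      = (\<Sum>i=0..n. (of_nat M * \<mu> gchoose Suc i) * fps_nth (inverse ?W) (n - i))" for M
  proof -
    let ?R = "fps_shift 1 (fps_binomial (of_nat M * \<mu>) - 1)" and ?G = "\<Sum>x<M. fps_binomial \<mu> ^ x"
    have "fps_X * ?R = fps_binomial (of_nat M * \<mu>) - 1"
      by (simp add: fps_eq_iff)
    also have "\<dots> = (fps_binomial \<mu> - 1) * ?G"
      by (simp flip: fps_binomial_power power_diff_1_eq)
    also have "fps_binomial \<mu> - 1 = fps_X * ?W"
      by (simp add: fps_eq_iff)
    finally have "?R = ?W * ?G"
      by (simp add: mult.assoc)
    then have "?R * inverse ?W = ?G * (inverse ?W * ?W)"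
      by (simp only: mult_ac)
    then have "fps_nth ?G n = fps_nth (?R * inverse ?W) n"
      by (simp only: W mult_1_right)
    then show ?thesis
      by (simp add: fps_mult_nth fps_sum_nth fps_binomial_power atLeast0LessThan)
  qed
  \<comment> \<open>For fixed \<open>n\<close> the number of summands is independent of
    \<open>N\<close>, so the limit is taken term by term.\<close>
  have "(\<lambda>N. \<Sum>i=0..n. (of_nat (p ^ N) * \<mu> gchoose Suc i) / of_nat p ^ N * fps_nth (inverse ?W) (n - i))
    \<longlonglongrightarrow> (\<Sum>i=0..n. \<mu> * ((- 1) ^ i / of_nat (Suc i)) * fps_nth (inverse ?W) (n - i))"
    by (intro padic_tendsto_sum padic_tendsto_mult gbinomial_power_p_tendsto tendsto_const)
  moreover have "(\<Sum>i=0..n. \<mu> * ((- 1) ^ i / of_nat (Suc i)) * fps_nth (inverse ?W) (n - i))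
      = fps_nth (bernoulli_gf \<mu>) n"
    unfolding bernoulli_gf_def fps_mult_nth by (simp add: fps_ln_nth del: of_nat_Suc)
  moreover have "(\<Sum>x = 0..<p ^ N. (of_nat x * \<mu> gchoose n)) / of_nat p ^ N
    = (\<Sum>i=0..n. (of_nat (p ^ N) * \<mu> gchoose Suc i) / of_nat p ^ N * fps_nth (inverse ?W) (n - i))" for N
    unfolding sum by (simp add: sum_divide_distrib)
  ultimately show ?thesis
    by simp
qed

text \<open>Rescaling by \<open>lam\<close> turns degenerate factorials into binomial coefficients
  of \<open>x / lam\<close>; the proven convergence identifies the value of
  \<open>lim\<close>.\<close>

lemma deg_bernoulli_conv_gf:
  assumes "lam \<noteq> (0 :: 'a)"
  shows "deg_bernoulli p n lam = fact n * lam ^ n * fps_nth (bernoulli_gf (1 / lam)) n"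
proof -
  have "(\<lambda>N. fact n * lam ^ n * ((\<Sum>x = 0..<p ^ N. (of_nat x * (1 / lam) gchoose n)) / of_nat p ^ N))
    \<longlonglongrightarrow> fact n * lam ^ n * fps_nth (bernoulli_gf (1 / lam)) n"
    using assms by (intro padic_tendsto_mult gbinomial_volkenborn_tendsto tendsto_const) simp
  then show ?thesis
    unfolding deg_bernoulli_def volkenborn_def using assms
    by (intro limI) (simp add: deg_falling_conv_gbinomial sum_distrib_left)
qed

text \<open>The sign \<open>(- 1) ^ n\<close> cancels that of \<open>(- lam) ^ n\<close>, so both
  families share the scaling \<open>fact n * lam ^ n\<close>.\<close>

lemma deg_bernoulli_minus_conv_gf:
  assumes "lam \<noteq> (0 :: 'a)"
  shows "(- 1) ^ n * deg_bernoulli p n (- lam) = fact n * lam ^ n * fps_nth (bernoulli_gf (- (1 / lam))) n"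
  using assms by (simp add: deg_bernoulli_conv_gf power_minus[of lam])

end

section \<open>The difference formula and the expansion of the degenerate hyperbolic
  cotangent\<close>

theorem theorem5:
  fixes p :: nat and lam :: "'a::{field_char_0, complete_space}"
  assumes "padic_complex p TYPE('a)"
    and "odd p"
    and "padic_abs lam \<ge> 1"
  shows "(\<forall>n\<ge>1. - fact (n - 1) * (- lam) ^ (n - 1)
            = deg_bernoulli p n lam - (- 1) ^ n * deg_bernoulli p n (- lam))
       \<and> (\<forall>a \<in> scaled_E_disc p lam. a \<noteq> 0 \<longrightarrow>
            (\<lambda>n. (\<Sum>m = 0..n. of_nat (n choose m)
                      * ((deg_bernoulli p m lam + (- 1) ^ m * deg_bernoulli p m (- lam)) / 2)
                      * cauchy_number (n - m) * lam ^ (n - m))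
                  * a ^ n / fact n)
            sums (a / 2 * deg_coth lam (1 / 2) a))"
proof -
  interpret padic_field "TYPE('a)" p
    using assms(1) unfolding padic_complex_def by unfold_locales blast+
  have lam: "lam \<noteq> 0"
    using assms(3) by auto
  define \<mu> where "\<mu> = 1 / lam"
  have \<mu>: "\<mu> \<noteq> 0" "padic_abs \<mu> \<le> 1"
    using lam assms(3) by (simp_all add: \<mu>_def padic_abs_divide)
  have "\<not> p dvd 2"
    using prime_p \<open>odd p\<close> by (metis even_numeral primes_dvd_imp_eq two_is_prime_nat)
  then have two: "padic_abs (2 :: 'a) = 1"
    using padic_abs_of_nat_eq_1[of 2] by simp
  note bernoulli = deg_bernoulli_conv_gf[OF lam, folded \<mu>_def]
    deg_bernoulli_minus_conv_gf[OF lam, folded \<mu>_def]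
  show ?thesis
  proof (intro conjI allI ballI impI)
    fix n :: nat assume "n \<ge> 1"
    then obtain m where n: "n = Suc m"
      by (cases n) simp_all
    have "deg_bernoulli p n lam - (- 1) ^ n * deg_bernoulli p n (- lam)
        = fact n * lam ^ n * fps_nth (bernoulli_gf \<mu> - bernoulli_gf (- \<mu>)) n"
      unfolding bernoulli by (simp add: algebra_simps)
    \<comment> \<open>The coefficient of \<open>\<mu> log (1 + X)\<close> at
      \<open>n = m + 1\<close> is \<open>\<mu> (-1)^m / n\<close>; the \<open>n\<close> reduces the
      factorial and \<open>\<mu>\<close> removes one power of \<open>lam\<close>.\<close>
    also have "\<dots> = - fact m * (- lam) ^ m"
      unfolding bernoulli_gf_diff[OF \<mu>(1)] n using lam
      by (simp add: fps_ln_nth \<mu>_def power_minus[of lam] del: of_nat_Suc)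
    finally show "- fact (n - 1) * (- lam) ^ (n - 1)
        = deg_bernoulli p n lam - (- 1) ^ n * deg_bernoulli p n (- lam)"
      by (simp add: n)
  next
    fix a assume a: "a \<in> scaled_E_disc p lam" "a \<noteq> 0"
    define t where "t = lam * a"
    have t: "t \<noteq> 0" "padic_abs t < rad"
      using a lam by (simp_all add: t_def scaled_E_disc_def E_disc_def rad_def)
    define T where "T = fps_const (1 / 2) * (bernoulli_gf \<mu> + bernoulli_gf (- \<mu>)) * (fps_X / fps_ln 1)"
    have half: "padic_abs (\<mu> / 2) \<le> 1"
      using \<mu> two by (simp add: padic_abs_divide)
    have exps: "deg_exp lam (1 / 2) a = fps_value (fps_binomial (\<mu> / 2)) t"
      "deg_exp lam (- (1 / 2)) a = fps_value (fps_binomial (- (\<mu> / 2))) t"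
      using padic_exp_log[OF t(2), of "\<mu> / 2"] padic_exp_log[OF t(2), of "- (\<mu> / 2)"] half
      by (simp_all add: deg_exp_def t_def \<mu>_def mult.commute)
    have "(\<lambda>n. fps_nth T n * t ^ n) sums
      (\<mu> / 2 * t * ((deg_exp lam (1 / 2) a + deg_exp lam (- (1 / 2)) a)
        / (deg_exp lam (1 / 2) a - deg_exp lam (- (1 / 2)) a)))"
      unfolding exps using \<mu> half t two coth_gf[OF \<mu>(1)] by (intro coth_sums) (simp_all add: T_def)
    moreover have coth: "deg_coth lam (1 / 2) a = (deg_exp lam (1 / 2) a + deg_exp lam (- (1 / 2)) a)
        / (deg_exp lam (1 / 2) a - deg_exp lam (- (1 / 2)) a)"
    proof -
      have "(x / 2) / (y / 2) = x / y" for x y :: 'a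
        by simp
      then show ?thesis
        by (simp only: deg_coth_def deg_cosh_def deg_sinh_def)
    qed
    moreover have "\<mu> / 2 * t = a / 2"
      using lam by (simp add: \<mu>_def t_def)
    moreover have "fps_nth T n * t ^ n = (\<Sum>m = 0..n. of_nat (n choose m)
          * ((deg_bernoulli p m lam + (- 1) ^ m * deg_bernoulli p m (- lam)) / 2)
          * cauchy_number (n - m) * lam ^ (n - m)) * a ^ n / fact n" for n
    proof -
      have "of_nat (n choose m)
          * ((deg_bernoulli p m lam + (- 1) ^ m * deg_bernoulli p m (- lam)) / 2)
          * cauchy_number (n - m) * lam ^ (n - m)
        = fact n * lam ^ n * (1 / 2 * fps_nth (bernoulli_gf \<mu> + bernoulli_gf (- \<mu>)) m
          * fps_nth (fps_X / fps_ln 1) (n - m))" if "m \<in> {0..n}" for m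
      proof -
        have "of_nat (n choose m) * (fact m * fact (n - m)) = (fact n :: 'a)"
          using that binomial_fact_lemma[of m n]
          by (metis atLeastAtMost_iff mult.commute of_nat_fact of_nat_mult)
        moreover have "lam ^ m * lam ^ (n - m) = lam ^ n"
          using that by (simp flip: power_add)
        \<comment> \<open>With factorials and powers abstracted to variables, this regroups the term
          so that the two preceding facts collapse the factorials and the powers of
          \<open>lam\<close>.\<close>
        moreover have "c * ((x * y * g + x * y * h) / 2) * (x' * k) * y'
          = c * (x * x') * (y * y') * (1 / 2 * (g + h) * k)" for c x y g h x' k y' :: 'a
          by (simp add: field_simps)
        ultimately show ?thesis
          unfolding bernoulli cauchy_number_def by (simp only: fps_add_nth)
      qed
      then have "(\<Sum>m = 0..n. of_nat (n choose m)
          * ((deg_bernoulli p m lam + (- 1) ^ m * deg_bernoulli p m (- lam)) / 2)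
          * cauchy_number (n - m) * lam ^ (n - m)) = fact n * lam ^ n * fps_nth T n"
        unfolding T_def fps_mult_nth[of "fps_const (1 / 2) * _"] sum_distrib_left
        by (intro sum.cong) simp_all
      then show ?thesis
        by (simp add: t_def power_mult_distrib)
    qed
    ultimately show "(\<lambda>n. (\<Sum>m = 0..n. of_nat (n choose m)
                      * ((deg_bernoulli p m lam + (- 1) ^ m * deg_bernoulli p m (- lam)) / 2)
                      * cauchy_number (n - m) * lam ^ (n - m))
                  * a ^ n / fact n)
            sums (a / 2 * deg_coth lam (1 / 2) a)"
      by (simp only: coth)
  qed
qed

end
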